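(* For a sequence $(c_0,c_1,c_2,\dots)$ let $H_n=\det(c_{i+j})_{0\le i,j\le n-1}$ ($n\ge1$), $H_0=1$. Let $r$ be a complex number and $n\ge 0$ an integer (products over empty ranges equal $1$). (H1) For $(E^{(r)}_0,0,E^{(r)}_2,0,E^{(r)}_4,0,\dots)$: $H_n=\prod_{k=1}^{n-1}k!\,r(r+1)\cdots(r+k-1)$; in particular for $(E_0,0,E_2,0,\dots)$, $H_n=\prod_{k=1}^{n-1}k!^2$. (H2) For $(E^{(r)}_0,E^{(r)}_2,E^{(r)}_4,\dots)$: $H_n=\prod_{k=1}^{n-1}(2k)!\,r(r+1)\cdots(r+2k-1)$; in particular for $(E_0,E_2,E_4,\dots)$, $H_n=\prod_{k=1}^{n-1}(2k)!^2$. (H3) For $(E^{(r)}_2,E^{(r)}_4,\dots)$: $H_n=\prod_{k=0}^{n-1}(2k+1)!\,r(r+1)\cdots(r+2k)$; in particular for $(E_2,E_4,\dots)$, $H_n=\prod_{k=1}^{n-1}(2k+1)!^2$. (H4) For $(E_1,0,E_3,0,E_5,\dots)$: $H_n=n!\prod_{k=1}^{n-1}k!^2$. (H5) For $(E_1,E_3,E_5,\dots)$: $H_n=\prod_{k=1}^{2n-1}k!$. (H6) For $(E_3,E_5,\dots)$: $H_n=\prod_{k=1}^{2n}k!$. (H7) For $(E_1,E_2,E_3,\dots)$: $H_n=\frac{n!}{2^{n(n-1)/2}}\prod_{k=2}^{n-1}k!^2$. (H8) For $(0,E^{(r)}_2/r,0,E^{(r)}_4/r,\dots)$ ($r\neq0$):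 $H_{2n+1}=0$, $H_{2n}=(-1)^n\prod_{k=1}^{n-1}\big((2k+1)!(r+1)(r+2)\cdots(r+2k)\big)^2$; equivalently for $(0,E^{(r)}_2,0,E^{(r)}_4,\dots)$: $H_{2n+1}=0$, $H_{2n}=(-1)^nr^2\prod_{k=1}^{n-1}\big((2k+1)!\,r(r+1)\cdots(r+2k)\big)^2$; in particular for $(0,E_2,0,E_4,\dots)$: $H_{2n+1}=0$, $H_{2n}=(-1)^n\prod_{k=1}^{n-1}(2k+1)!^4$. (H9) For $(0,E_1,0,E_3,0,E_5,\dots)$: $H_{2n+1}=0$, $H_{2n}=(-1)^n\prod_{k=1}^{2n-1}k!^2$. (H10) For $(E_2,E_3,E_4,\dots)$: $H_0=1$, and $H_{4k}=\frac{(-1)^kk^2(2k-1)!^2}{2^{8k^2-4k-2}}\prod_{j=1}^{2k-1}(2j+1)!^4$ ($k\ge1$), $H_{4k+1}=\frac{(-1)^k(2k)!^2}{2^{8k^2}(4k+1)!^2}\prod_{j=1}^{2k}(2j+1)!^4$, $H_{4k+2}=\frac{(-1)^k(2k+1)!^2}{2^{8k^2+4k}}\prod_{j=1}^{2k}(2j+1)!^4$, $H_{4k+3}=0$ ($k\ge0$). (H11) For $(0,E_3,0,E_5,\dots)$: $H_{2n+1}=0$ and $H_{2n}=(-1)^n\prod_{k=1}^{2n}k!^2$.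
   Context: The Euler numbers $E_n$ are defined by $\tan(x)+\sec(x)=\sum_{n\ge0}E_nx^n/n!$; for a parameter $r$, $E^{(r)}_{2n}$ are defined by $(\sec x)^r=\sum_{n\ge0}E^{(r)}_{2n}\frac{x^{2n}}{(2n)!}$.
   Formalization: In (H8), the formula for H_{2n} of the sequence (0,E^{(r)}_2,0,E^{(r)}_4,…) with factor r^2 is stated only for n≥1, since at n=0 it would give r^2 instead of H_0=1. *)

theory Defs
  imports Complex_Main
    "HOL-Computational_Algebra.Formal_Power_Series"
    "Jordan_Normal_Form.Determinant"
begin

text \<open>The \<open>0 \<times> 0\<close> matrix has determinant \<open>1\<close>, so \<open>hankel c 0 = 1\<close>.\<close>

definition hankel :: "(nat \<Rightarrow> 'a :: comm_ring_1) \<Rightarrow> nat \<Rightarrow> 'a" where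
  "hankel c n = Determinant.det (Matrix.mat n n (\<lambda>(i, j). c (i + j)))"

definition fps_sec :: "complex fps" where
  "fps_sec = inverse (fps_cos 1)"

definition euler_num :: "nat \<Rightarrow> complex" where
  "euler_num n = fact n * fps_nth (fps_tan 1 + fps_sec) n"

text \<open>
  For complex \<open>r\<close> the power \<open>(sec x)\<^sup>r\<close> is read as the binomial series
  \<open>(1 + u)\<^sup>r = \<Sum>k. (r gchoose k) * u\<^sup>k\<close> at \<open>u = sec x - 1\<close>, which has no constant term.
  It is the power series at \<open>0\<close> of the principal branch of \<open>(sec x) powr r\<close>.
\<close>

definition fps_sec_powr :: "complex \<Rightarrow> complex fps" where
  "fps_sec_powr r = fps_compose (fps_binomial r) (fps_sec - 1)"

text \<open>The index is the subscript of \<open>E\<^sup>(\<^sup>r\<^sup>)\<close>; only even ones occur, as \<open>sec\<close> is even.\<close>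

definition euler_num_gen :: "complex \<Rightarrow> nat \<Rightarrow> complex" where
  "euler_num_gen r m = fact m * fps_nth (fps_sec_powr r) m"

end

theory Submission
  imports Defs
begin

text \<open>
  All sequences arise as columns of arrays obeying the three-term recurrence of a tridiagonal
  (Jacobi) matrix \<open>J\<close>. If a kernel \<open>T\<close> satisfies \<open>J T = T J\<^sup>T\<close> and its row \<open>0\<close> is the \<open>m\<close>-th unit vector,
  then \<open>A T A\<^sup>T\<close> is the Hankel matrix of column \<open>m\<close>; as \<open>A\<close> is unitriangular, the Hankel determinant
  is a leading minor of \<open>T\<close>. For column \<open>0\<close> the kernel is diagonal, for its shift and (when
  \<open>J\<close> has zero diagonal) for column \<open>1\<close> it is tridiagonal.
  The array with columns \<open>(sec x)\<^sup>r (tan x)\<^sup>k / k!\<close> gives every case except (H7) and (H10): its column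
  \<open>0\<close> is \<open>(sec x)\<^sup>r\<close>, the tangent numbers occur both for \<open>r = 2\<close>, since \<open>tan' = sec\<^sup>2\<close>, and as column
  \<open>1\<close> for \<open>r = 0\<close>, and even and odd sections of the array again obey such recurrences.
  For (H7) and (H10) one uses \<open>F = tan + sec\<close>, which satisfies \<open>2 F' = 1 + F\<^sup>2\<close>.
\<close>

section \<open>Determinants\<close>

lemma sum_atMost_eq_sum_lessThan:
  fixes f g :: "nat \<Rightarrow> 'a :: comm_semiring_1"
  assumes "i < n"
  shows "(\<Sum>k\<le>i. f k * g k) = (\<Sum>k<n. (if k \<le> i then f k else 0) * g k)"
  using assms by (intro sum.mono_neutral_cong_left) auto

lemma det_unitriangular:
  fixes f :: "nat \<Rightarrow> nat \<Rightarrow> 'a :: comm_ring_1"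
  assumes "\<And>i. f i i = 1"
  shows "det (mat n n (\<lambda>(i, j). if j \<le> i then f i j else 0)) = 1"
proof -
  have "det (mat n n (\<lambda>(i, j). if j \<le> i then f i j else 0))
      = prod_list (diag_mat (mat n n (\<lambda>(i, j). if j \<le> i then f i j else 0)))"
    by (rule det_lower_triangular[where n = n]) auto
  also have "\<dots> = 1"
    unfolding prod_list_diag_prod by (simp add: assms)
  finally show ?thesis .
qed

text \<open>The hypothesis on \<open>c\<close> factors the infinite Hankel matrix as L T L^t with L
  lower unitriangular. Row i of L stops at column i, so the factorization restricts to leading n by
  n blocks, and det L = 1.\<close>

lemma hankel_congruence:
  fixes a T :: "nat \<Rightarrow> nat \<Rightarrow> 'a :: comm_ring_1"
  assumes a: "\<And>i. a i i = 1"
    and c: "\<And>i j. c (i + j) = (\<Sum>p\<le>i. a i p * (\<Sum>q\<le>j. a j q * T p q))"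
  shows "hankel c n = det (mat n n (\<lambda>(p, q). T p q))"
proof -
  define L where "L = mat n n (\<lambda>(i, j). if j \<le> i then a i j else 0)"
  define M where "M = mat n n (\<lambda>(p, q). T p q)"
  have L: "L \<in> carrier_mat n n" and M: "M \<in> carrier_mat n n"
    by (simp_all add: L_def M_def)
  have "mat n n (\<lambda>(i, j). c (i + j)) = L * (M * transpose_mat L)"
  proof (rule eq_matI)
    fix i j assume ij: "i < dim_row (L * (M * transpose_mat L))"
      "j < dim_col (L * (M * transpose_mat L))"
    hence i: "i < n" and j: "j < n" using L by auto
    have "(L * (M * transpose_mat L)) $$ (i, j)
        = (\<Sum>p<n. (if p \<le> i then a i p else 0) * (\<Sum>q<n. (if q \<le> j then a j q else 0) * T p q))"
      using i j by (simp add: L_def M_def scalar_prod_def lessThan_atLeast0 mult.commute)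
    also have "\<dots> = c (i + j)"
      using i j by (simp add: c sum_atMost_eq_sum_lessThan)
    finally show "mat n n (\<lambda>(i, j). c (i + j)) $$ (i, j) = (L * (M * transpose_mat L)) $$ (i, j)"
      using i j by simp
  qed (use L in auto)
  hence "hankel c n = det L * (det M * det (transpose_mat L))"
    unfolding hankel_def using L M by (simp add: det_mult[of _ n] mult_carrier_mat[of _ n n])
  also have "det (transpose_mat L) = det L" by (rule det_transpose[OF L])
  also have "det L = 1" unfolding L_def by (rule det_unitriangular) (rule a)
  finally show ?thesis by (simp add: M_def)
qed

lemma hankel_scale:
  fixes c :: "nat \<Rightarrow> 'a :: comm_ring_1"
  shows "hankel (\<lambda>m. s * c m) n = s ^ n * hankel c n"
proof -
  have "mat n n (\<lambda>(i, j). s * c (i + j)) = s \<cdot>\<^sub>m mat n n (\<lambda>(i, j). c (i + j))"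
    by (rule eq_matI) auto
  thus ?thesis by (simp add: hankel_def)
qed

lemma hankel_cong: "(\<And>m. c m = d m) \<Longrightarrow> hankel c n = hankel d n"
  by (simp add: hankel_def)

section \<open>Symmetric tridiagonal determinants; \<open>e = 0\<close> covers the diagonal
  case\<close>

definition tridiag :: "(nat \<Rightarrow> 'a :: zero) \<Rightarrow> (nat \<Rightarrow> 'a) \<Rightarrow> nat \<Rightarrow> nat \<Rightarrow> 'a" where
  "tridiag d e p q = (if p = q then d p else if q = Suc p then e p else if p = Suc q then e q else 0)"

definition det_tridiag :: "(nat \<Rightarrow> 'a :: comm_ring_1) \<Rightarrow> (nat \<Rightarrow> 'a) \<Rightarrow> nat \<Rightarrow> 'a" where
  "det_tridiag d e n = det (mat n n (\<lambda>(p, q). tridiag d e p q))"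

lemma det_tridiag_0: "det_tridiag d e 0 = 1"
  by (simp add: det_tridiag_def)

lemma det_tridiag_1: "det_tridiag d e (Suc 0) = d 0"
proof -
  have "mat (Suc 0) (Suc 0) (\<lambda>(p, q). tridiag d e p q) \<in> carrier_mat (Suc 0) (Suc 0)" by simp
  from laplace_expansion_row[OF this, of 0] show ?thesis
    by (simp add: det_tridiag_def cofactor_def tridiag_def mat_delete_def)
qed

text \<open>The continuant recurrence: expansion along the last row leaves two minors, and the one
  belonging to \<open>e n\<close> is expanded along its last column.\<close>

lemma det_tridiag_Suc_Suc:
  "det_tridiag d e (Suc (Suc n)) = d (Suc n) * det_tridiag d e (Suc n) - (e n)\<^sup>2 * det_tridiag d e n"
proof -
  define M where "M n = mat n n (\<lambda>(p, q). tridiag d e p q)" for n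
  have dM: "det_tridiag d e n = det (M n)" for n by (simp add: det_tridiag_def M_def)
  define A where "A = M (Suc (Suc n))"
  define B where "B = mat_delete A (Suc n) n"
  have A: "A \<in> carrier_mat (Suc (Suc n)) (Suc (Suc n))" by (simp add: A_def M_def)
  have B: "B \<in> carrier_mat (Suc n) (Suc n)" unfolding B_def using mat_delete_carrier[OF A] by simp
  \<comment> \<open>The last column of \<open>B\<close> comes from the last column of
    \<open>A\<close> with its bottom entry removed, so only \<open>e n\<close> survives.\<close>
  have Bn: "B $$ (p, n) = (if p = n then e n else 0)" if "p < Suc n" for p
    using that by (auto simp: B_def A_def M_def mat_delete_def tridiag_def)
  have Bd: "mat_delete B n n = M n"
    by (rule eq_matI) (auto simp: B_def A_def M_def mat_delete_def)
  have Ad: "mat_delete A (Suc n) (Suc n) = M (Suc n)"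
    by (rule eq_matI) (auto simp: A_def M_def mat_delete_def)
  have "det B = (\<Sum>i<Suc n. B $$ (i, n) * cofactor B i n)"
    by (rule laplace_expansion_column[OF B]) simp
  also have "\<dots> = (\<Sum>i\<in>{n}. B $$ (i, n) * cofactor B i n)"
    by (rule sum.mono_neutral_right) (auto simp: Bn)
  also have "\<dots> = e n * det (M n)" by (simp add: Bn cofactor_def Bd)
  finally have detB: "det B = e n * det (M n)" .
  have "det A = (\<Sum>j<Suc (Suc n). A $$ (Suc n, j) * cofactor A (Suc n) j)"
    by (rule laplace_expansion_row[OF A]) simp
  also have "\<dots> = (\<Sum>j\<in>{n, Suc n}. A $$ (Suc n, j) * cofactor A (Suc n) j)"
    by (rule sum.mono_neutral_right) (auto simp: A_def M_def tridiag_def)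
  also have "\<dots> = e n * - det B + d (Suc n) * det (M (Suc n))"
  proof -
    have "A $$ (Suc n, n) = e n" "A $$ (Suc n, Suc n) = d (Suc n)"
      by (simp_all add: A_def M_def tridiag_def)
    moreover have "cofactor A (Suc n) n = - det B" "cofactor A (Suc n) (Suc n) = det (M (Suc n))"
      by (simp_all add: cofactor_def B_def Ad)
    ultimately show ?thesis by simp
  qed
  finally show ?thesis by (simp add: dM A_def[symmetric] detB power2_eq_square algebra_simps)
qed

lemma det_tridiag_diagonal: "det_tridiag d (\<lambda>_. 0) n = (\<Prod>k<n. d k)"
proof (induction n rule: induct_nat_012)
  case (ge2 n)
  thus ?case by (simp add: det_tridiag_Suc_Suc mult.commute)
qed (simp_all add: det_tridiag_0 det_tridiag_1)

text \<open>Without a diagonal the recurrence goes in steps of two, so the two parities decouple,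
  with initial values 1 and 0.\<close>

lemma det_tridiag_offdiagonal:
  "det_tridiag (\<lambda>_. 0) e (2 * n) = (- 1) ^ n * (\<Prod>k<n. (e (2 * k))\<^sup>2)"
  "det_tridiag (\<lambda>_. 0) e (2 * n + 1) = 0"
proof (induction n)
  case (Suc n)
  have "2 * Suc n = Suc (Suc (2 * n))" "2 * Suc n + 1 = Suc (Suc (2 * n + 1))" by simp_all
  thus "det_tridiag (\<lambda>_. 0) e (2 * Suc n) = (- 1) ^ Suc n * (\<Prod>k<Suc n. (e (2 * k))\<^sup>2)"
    "det_tridiag (\<lambda>_. 0) e (2 * Suc n + 1) = 0"
    by (simp_all only: det_tridiag_Suc_Suc Suc.IH) simp_all
qed (simp_all add: det_tridiag_0 det_tridiag_1)

section \<open>Stieltjes arrays\<close>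

text \<open>\<open>A n k\<close> is the weighted count of Motzkin paths of length n from height 0 to
  height k: up steps have weight 1, level steps at height k weight \<open>b k\<close>, down steps
  from k + 1 to k weight \<open>l k\<close>. In matrix terms, row n + 1 is row n times J.\<close>

locale stieltjes_array =
  fixes A :: "nat \<Rightarrow> nat \<Rightarrow> 'a :: comm_ring_1" and b l :: "nat \<Rightarrow> 'a"
  assumes A_0: "A 0 k = (if k = 0 then 1 else 0)"
    and A_Suc: "A (Suc n) k = (if k = 0 then 0 else A n (k - 1)) + b k * A n k + l k * A n (Suc k)"
begin

lemma A_above: "n < k \<Longrightarrow> A n k = 0"
  by (induction n arbitrary: k) (auto simp: A_0 A_Suc)

lemma A_diag [simp]: "A n n = 1"
  by (induction n) (auto simp: A_0 A_Suc A_above)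

definition row_fun :: "nat \<Rightarrow> (nat \<Rightarrow> 'a) \<Rightarrow> 'a" where
  "row_fun n U = (\<Sum>k\<le>n. A n k * U k)"

text \<open>The action of J on column vectors, dual to its action on the rows of
  \<open>A\<close>.\<close>

definition adj :: "(nat \<Rightarrow> 'a) \<Rightarrow> nat \<Rightarrow> 'a" where
  "adj U k = U (Suc k) + b k * U k + (if k = 0 then 0 else l (k - 1) * U (k - 1))"

lemma row_fun_0: "row_fun 0 U = U 0"
  by (simp add: row_fun_def)

lemma row_fun_unit: "row_fun n (\<lambda>k. if k = m then 1 else 0) = A n m"
  by (simp add: row_fun_def A_above if_distrib cong: if_cong)

text \<open>Summation by parts: index shifts in the up and down terms move J from the row to the
  vector \<open>U\<close>.\<close>

lemma row_fun_Suc: "row_fun (Suc n) U = row_fun n (adj U)"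
proof -
  have 1: "(\<Sum>k\<le>Suc n. (if k = 0 then 0 else A n (k - 1)) * U k) = (\<Sum>k\<le>n. A n k * U (Suc k))"
    by (subst sum.atMost_Suc_shift) simp
  have 2: "(\<Sum>k\<le>Suc n. b k * A n k * U k) = (\<Sum>k\<le>n. A n k * (b k * U k))"
    by (simp add: A_above algebra_simps)
  \<comment> \<open>Two vanishing terms are appended, so that after the shift the range is that of
    row n + 1.\<close>
  have "(\<Sum>k\<le>n. A n k * (if k = 0 then 0 else l (k - 1) * U (k - 1)))
      = (\<Sum>k\<le>Suc (Suc n). A n k * (if k = 0 then 0 else l (k - 1) * U (k - 1)))"
    by (simp add: A_above)
  also have "\<dots> = (\<Sum>k\<le>Suc n. l k * A n (Suc k) * U k)"
    by (subst sum.atMost_Suc_shift) (simp add: algebra_simps)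
  finally show ?thesis
    unfolding row_fun_def adj_def A_Suc
    by (simp add: distrib_right distrib_left sum.distrib 1 2 del: sum.atMost_Suc)
qed

lemma adj_row_fun:
  "adj (\<lambda>p. row_fun j (T p)) = (\<lambda>p. row_fun j (\<lambda>q. adj (\<lambda>p. T p q) p))"
  by (rule ext) (simp add: adj_def row_fun_def sum.distrib sum_distrib_left algebra_simps)

text \<open>For \<open>i = 0\<close> the unit vector picks out \<open>A j m\<close>. By
  \<open>comm\<close> an application of J on the index p may be moved to q, so raising i by one
  amounts to raising j by one; hence the induction on i for all j.\<close>

lemma kernel:
  assumes "\<And>q. T 0 q = (if q = m then 1 else 0)"
    and comm: "\<And>p q. adj (\<lambda>p. T p q) p = adj (\<lambda>q. T p q) q"
  shows "row_fun i (\<lambda>p. row_fun j (\<lambda>q. T p q)) = A (i + j) m"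
proof (induction i arbitrary: j)
  case 0
  have "T 0 = (\<lambda>q. if q = m then 1 else 0)" by (rule ext) (rule assms(1))
  thus ?case by (simp add: row_fun_0 row_fun_unit)
next
  case (Suc i)
  have "adj (\<lambda>p. row_fun j (T p)) = (\<lambda>p. row_fun (Suc j) (T p))"
    by (simp add: adj_row_fun comm row_fun_Suc)
  hence "row_fun (Suc i) (\<lambda>p. row_fun j (T p)) = row_fun i (\<lambda>p. row_fun (Suc j) (T p))"
    by (simp add: row_fun_Suc)
  also have "\<dots> = A (Suc i + j) m" by (simp add: Suc.IH)
  finally show ?case .
qed

lemma hankel_kernel:
  assumes "\<And>i j. row_fun i (\<lambda>p. row_fun j (\<lambda>q. T p q)) = c (i + j)"
  shows "hankel c n = det (mat n n (\<lambda>(p, q). T p q))"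
  by (rule hankel_congruence[of A]) (simp_all add: assms[symmetric] row_fun_def)

text \<open>The formal squared norm of the k-th monic orthogonal polynomial for the moments
  \<open>A n 0\<close>.\<close>

abbreviation weight :: "nat \<Rightarrow> 'a" where
  "weight k \<equiv> \<Prod>j<k. l j"

text \<open>The diagonal matrix D of the weights satisfies J D = D J^t because
  \<open>weight (Suc k) = weight k * l k\<close>.\<close>

lemma kernel_column_0:
  "row_fun i (\<lambda>p. row_fun j (\<lambda>q. tridiag weight (\<lambda>_. 0) p q)) = A (i + j) 0"
proof (rule kernel)
  fix p q
  show "adj (\<lambda>p. tridiag weight (\<lambda>_. 0) p q) p = adj (\<lambda>q. tridiag weight (\<lambda>_. 0) p q) q"
    by (cases p; cases q) (auto simp: adj_def tridiag_def)
qed (auto simp: tridiag_def)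

theorem hankel_column_0: "hankel (\<lambda>m. A m 0) n = (\<Prod>k<n. weight k)"
  using hankel_kernel[OF kernel_column_0] by (simp add: det_tridiag_def[symmetric] det_tridiag_diagonal)

text \<open>Raising i by one in \<open>kernel_column_0\<close> replaces the kernel D by J D, which
  is tridiagonal and symmetric.\<close>

theorem hankel_shifted_column_0:
  "hankel (\<lambda>m. A (Suc m) 0) n = det_tridiag (\<lambda>k. b k * weight k) (\<lambda>k. weight (Suc k)) n"
proof -
  have adj: "adj (\<lambda>p. tridiag weight (\<lambda>_. 0) p q) p
      = tridiag (\<lambda>k. b k * weight k) (\<lambda>k. weight (Suc k)) p q" for p q
    by (cases p; cases q) (auto simp: adj_def tridiag_def)
  have "row_fun i (\<lambda>p. row_fun j (\<lambda>q. tridiag (\<lambda>k. b k * weight k) (\<lambda>k. weight (Suc k)) p q))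
      = A (Suc (i + j)) 0" for i j
    using kernel_column_0[of "Suc i" j] by (simp only: row_fun_Suc adj_row_fun adj add_Suc)
  from hankel_kernel[OF this] show ?thesis by (simp add: det_tridiag_def)
qed

text \<open>The first row of the kernel must be the unit vector at 1, so the diagonal is taken to be
  0 and the first off-diagonal entry is 1. Commutation with J then multiplies successive
  off-diagonal entries by \<open>l (Suc k)\<close>.\<close>

theorem hankel_column_1:
  assumes b: "\<And>k. b k = 0"
  shows "hankel (\<lambda>m. A m 1) n = det_tridiag (\<lambda>_. 0) (\<lambda>k. \<Prod>j<k. l (Suc j)) n"
proof -
  let ?T = "tridiag (\<lambda>_. 0) (\<lambda>k. \<Prod>j<k. l (Suc j))"
  have "row_fun i (\<lambda>p. row_fun j (\<lambda>q. ?T p q)) = A (i + j) 1" for i j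
  proof (rule kernel)
    fix p q
    show "adj (\<lambda>p. ?T p q) p = adj (\<lambda>q. ?T p q) q"
      by (cases p; cases q) (auto simp: adj_def tridiag_def b)
  qed (auto simp: tridiag_def)
  from hankel_kernel[OF this] show ?thesis by (simp add: det_tridiag_def)
qed

text \<open>Without level steps, two steps preserve the parity of the height. From 2k one returns by
  up-down with weight \<open>l (2 * k)\<close> or by down-up with weight
  \<open>l (2 * k - 1)\<close>, the latter being impossible at height 0; two down steps from 2k + 2
  multiply their weights.\<close>

lemma even_contraction:
  assumes "\<And>k. b k = 0"
  shows "stieltjes_array (\<lambda>n k. A (2 * n) (2 * k))
    (\<lambda>k. (if k = 0 then 0 else l (2 * k - 1)) + l (2 * k)) (\<lambda>k. l (2 * k) * l (2 * k + 1))"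
proof
  fix n k
  show "A (2 * Suc n) (2 * k) = (if k = 0 then 0 else A (2 * n) (2 * (k - 1)))
      + ((if k = 0 then 0 else l (2 * k - 1)) + l (2 * k)) * A (2 * n) (2 * k)
      + l (2 * k) * l (2 * k + 1) * A (2 * n) (2 * Suc k)"
    by (cases k) (simp_all add: A_Suc assms algebra_simps)
qed (simp add: A_0)

text \<open>The same pairing of steps at odd heights, started from row 1, which is the unit vector
  at 1.\<close>

lemma odd_contraction:
  assumes "\<And>k. b k = 0"
  shows "stieltjes_array (\<lambda>n k. A (2 * n + 1) (2 * k + 1))
    (\<lambda>k. l (2 * k) + l (2 * k + 1)) (\<lambda>k. l (2 * k + 1) * l (2 * k + 2))"
proof
  fix n k
  show "A (2 * Suc n + 1) (2 * k + 1) = (if k = 0 then 0 else A (2 * n + 1) (2 * (k - 1) + 1))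
      + (l (2 * k) + l (2 * k + 1)) * A (2 * n + 1) (2 * k + 1)
      + l (2 * k + 1) * l (2 * k + 2) * A (2 * n + 1) (2 * Suc k + 1)"
    by (cases k) (simp_all add: A_Suc assms algebra_simps)
next
  fix k
  show "A (2 * 0 + 1) (2 * k + 1) = (if k = 0 then 1 else 0)"
    by (simp add: A_Suc A_0 assms)
qed

lemma parity:
  assumes "\<And>k. b k = 0" and "odd (n + k)"
  shows "A n k = 0"
  using assms(2) by (induction n arbitrary: k) (auto simp: A_0 A_Suc assms(1) odd_pos)

end

section \<open>Exponential Riordan arrays\<close>

lemma fact_Suc_fps_nth: "fact (Suc n) * fps_nth F (Suc n) = (fact n * fps_nth (fps_deriv F) n :: 'a :: field_char_0)"
  by (simp add: algebra_simps)

text \<open>Differentiation raises n by one. The Riccati equation for f and the equation for g'/g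
  express (g f^k)' through g f^(k-1), g f^k and g f^(k+1); division by k! normalizes the coefficient
  of the first to 1.\<close>

lemma stieltjes_array_riordan:
  fixes f g :: "'a :: field_char_0 fps"
  assumes f0: "fps_nth f 0 = 0" and g0: "fps_nth g 0 = 1"
    and f': "fps_deriv f = 1 + fps_const \<beta> * f + fps_const \<gamma> * f\<^sup>2"
    and g': "fps_deriv g = g * (fps_const \<mu> + fps_const \<nu> * f)"
  shows "stieltjes_array (\<lambda>n k. fact n * fps_nth (g * f ^ k) n / fact k)
    (\<lambda>k. \<mu> + of_nat k * \<beta>) (\<lambda>k. of_nat (Suc k) * (\<nu> + of_nat k * \<gamma>))"
proof
  fix k
  show "fact 0 * fps_nth (g * f ^ k) 0 / fact k = (if k = 0 then 1 else 0)"
    by (simp add: f0 g0 power_0_left)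
next
  fix n k
  \<comment> \<open>For \<open>k = 0\<close> the truncated exponent \<open>k - 1\<close> is
    harmless, as its factor \<open>of_nat k\<close> vanishes.\<close>
  have deriv: "fps_deriv (g * f ^ k) = fps_const (of_nat k) * (g * f ^ (k - 1))
      + fps_const (\<mu> + of_nat k * \<beta>) * (g * f ^ k) + fps_const (\<nu> + of_nat k * \<gamma>) * (g * f ^ Suc k)"
  proof (cases k)
    case 0
    thus ?thesis by (simp add: g' algebra_simps)
  next
    case (Suc j)
    have "fps_deriv (g * f ^ k) = g * (fps_const (of_nat k) * fps_deriv f * f ^ j) + fps_deriv g * f ^ k"
      by (simp only: fps_deriv_mult fps_deriv_power Suc) simp
    also have "\<dots> = fps_const (of_nat k) * (g * f ^ j)
      + fps_const (\<mu> + of_nat k * \<beta>) * (g * f ^ k) + fps_const (\<nu> + of_nat k * \<gamma>) * (g * f ^ Suc k)"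
      by (simp only: f' g' Suc fps_const_add[symmetric] fps_const_mult[symmetric])
        (simp add: algebra_simps power2_eq_square del: fps_const_add fps_const_mult of_nat_Suc)
    finally show ?thesis by (simp add: Suc)
  qed
  have k1: "of_nat k / fact k = (if k = 0 then 0 else 1 / fact (k - 1) :: 'a)"
    by (cases k) (simp_all add: field_simps del: of_nat_Suc)
  have k2: "1 / fact k = (of_nat (Suc k) / fact (Suc k) :: 'a)"
    by (simp add: field_simps del: of_nat_Suc)
  have "fact (Suc n) * fps_nth (g * f ^ k) (Suc n) / fact k
      = fact n * fps_nth (fps_deriv (g * f ^ k)) n / fact k"
    by (simp only: fact_Suc_fps_nth)
  also have "\<dots> = of_nat k / fact k * (fact n * fps_nth (g * f ^ (k - 1)) n)
      + (\<mu> + of_nat k * \<beta>) * (fact n * fps_nth (g * f ^ k) n / fact k)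
      + (\<nu> + of_nat k * \<gamma>) * (fact n * fps_nth (g * f ^ Suc k) n) * (1 / fact k)"
    by (simp only: deriv fps_add_nth fps_mult_left_const_nth) (simp add: field_simps)
  also have "\<dots> = (if k = 0 then 0 else fact n * fps_nth (g * f ^ (k - 1)) n / fact (k - 1))
      + (\<mu> + of_nat k * \<beta>) * (fact n * fps_nth (g * f ^ k) n / fact k)
      + of_nat (Suc k) * (\<nu> + of_nat k * \<gamma>) * (fact n * fps_nth (g * f ^ Suc k) n / fact (Suc k))"
    unfolding k1 k2 by (simp del: of_nat_Suc fact_Suc power_Suc)
  finally show "fact (Suc n) * fps_nth (g * f ^ k) (Suc n) / fact k
      = (if k = 0 then 0 else fact n * fps_nth (g * f ^ (k - 1)) n / fact (k - 1))
      + (\<mu> + of_nat k * \<beta>) * (fact n * fps_nth (g * f ^ k) n / fact k)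
      + of_nat (Suc k) * (\<nu> + of_nat k * \<gamma>) * (fact n * fps_nth (g * f ^ Suc k) n / fact (Suc k))" .
qed

section \<open>Powers of the secant\<close>

lemma fps_cos_mult_sec: "fps_cos 1 * fps_sec = 1"
  unfolding fps_sec_def by (rule inverse_mult_eq_1') simp

lemma fps_sec_0 [simp]: "fps_nth fps_sec 0 = 1"
  by (simp add: fps_sec_def)

lemma fps_tan_eq: "fps_tan 1 = fps_sin 1 * fps_sec"
  by (simp add: fps_tan_def fps_sec_def fps_divide_unit)

lemma fps_tan_0 [simp]: "fps_nth (fps_tan (1 :: complex)) 0 = 0"
  by (simp add: fps_tan_eq)

lemma fps_sec_squared: "fps_sec\<^sup>2 = 1 + (fps_tan 1)\<^sup>2"
proof -
  have "1 + (fps_tan 1)\<^sup>2 = (fps_cos 1 * fps_sec)\<^sup>2 + (fps_sin 1 * fps_sec)\<^sup>2"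
    by (simp add: fps_cos_mult_sec fps_tan_eq)
  also have "\<dots> = fps_sec\<^sup>2 * ((fps_cos 1)\<^sup>2 + (fps_sin 1)\<^sup>2)"
    by (simp add: power_mult_distrib algebra_simps)
  finally show ?thesis by (simp add: fps_sin_cos_sum_of_squares)
qed

lemma fps_deriv_tan: "fps_deriv (fps_tan 1) = fps_sec\<^sup>2"
  by (simp add: fps_tan_deriv fps_sec_def fps_divide_unit fps_inverse_power)

lemma fps_deriv_sec: "fps_deriv fps_sec = fps_tan 1 * fps_sec"
proof -
  have "fps_const (- 1) = (- 1 :: complex fps)"
    by (metis fps_const_1_eq_1 fps_const_neg)
  thus ?thesis
    by (simp add: fps_sec_def fps_inverse_deriv fps_cos_deriv fps_tan_eq power2_eq_square mult_ac)
qed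

lemma fps_sec_powr_0 [simp]: "fps_nth (fps_sec_powr r) 0 = 1"
  by (simp add: fps_sec_powr_def)

lemma fps_sec_powr_of_nat: "fps_sec_powr (of_nat n) = fps_sec ^ n"
proof -
  have "(1 + fps_X) oo (fps_sec - 1) = fps_sec"
    by (simp add: fps_compose_add_distrib)
  thus ?thesis
    by (simp add: fps_sec_powr_def fps_binomial_of_nat fps_compose_power[symmetric])
qed

text \<open>The binomial series B satisfies (1 + X) B' = r B. Composition with sec - 1 turns 1 + X
  into sec, and the chain rule contributes sec' = sec tan.\<close>

lemma fps_deriv_sec_powr: "fps_deriv (fps_sec_powr r) = fps_const r * fps_tan 1 * fps_sec_powr r"
proof -
  let ?B = "fps_binomial r" and ?u = "fps_sec - 1"
  have u0: "fps_nth ?u 0 = 0" by simp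
  have "fps_const r * ?B = fps_deriv ?B * (1 + fps_X)"
    by (simp add: fps_binomial_deriv fps_divide_unit mult.assoc inverse_mult_eq_1)
  hence "(fps_const r * ?B) oo ?u = (fps_deriv ?B oo ?u) * ((1 + fps_X) oo ?u)"
    using fps_compose_mult_distrib[OF u0] by simp
  also have "(1 + fps_X) oo ?u = fps_sec" by (simp add: fps_compose_add_distrib)
  finally have "(fps_deriv ?B oo ?u) * fps_sec = fps_const r * fps_sec_powr r"
    using fps_compose_mult_distrib[OF u0] by (simp add: fps_sec_powr_def)
  moreover have "fps_deriv (fps_sec_powr r) = (fps_deriv ?B oo ?u) * fps_sec * fps_tan 1"
    unfolding fps_sec_powr_def by (simp add: fps_compose_deriv[OF u0] fps_deriv_sec mult_ac)
  ultimately show ?thesis by (simp add: mult_ac)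
qed

definition sec_tan :: "complex \<Rightarrow> nat \<Rightarrow> nat \<Rightarrow> complex" where
  "sec_tan r n k = fact n * fps_nth (fps_sec_powr r * fps_tan 1 ^ k) n / fact k"

text \<open>Here f = tan with f' = 1 + f^2, and g = sec^r with g' = r g f.\<close>

interpretation sec_tan: stieltjes_array "sec_tan r" "\<lambda>_. 0" "\<lambda>k. of_nat (Suc k) * (r + of_nat k)" for r
proof -
  have "sec_tan r = (\<lambda>n k. fact n * fps_nth (fps_sec_powr r * fps_tan 1 ^ k) n / fact k)"
    by (intro ext) (simp add: sec_tan_def)
  thus "stieltjes_array (sec_tan r) (\<lambda>_. 0) (\<lambda>k. of_nat (Suc k) * (r + of_nat k))"
    using stieltjes_array_riordan[of "fps_tan 1" "fps_sec_powr r" 0 1 0 r]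
    by (simp add: fps_deriv_tan fps_sec_squared fps_deriv_sec_powr mult_ac)
qed

text \<open>The second equation is the recurrence in column 0, whose only weight is
  \<open>l 0 = r\<close>; it reduces shifted sequences to column 1.\<close>

lemma euler_num_gen_eq_sec_tan:
  "euler_num_gen r m = sec_tan r m 0" "euler_num_gen r (Suc m) = r * sec_tan r m 1"
proof -
  show eq: "euler_num_gen r m = sec_tan r m 0" for m
    by (simp add: euler_num_gen_def sec_tan_def)
  show "euler_num_gen r (Suc m) = r * sec_tan r m 1"
    by (simp add: eq sec_tan.A_Suc)
qed

text \<open>sec is column 0 for \<open>r = 1\<close> and tan is column 1 for \<open>r = 0\<close>;
  parity kills one of the two summands.\<close>

lemma euler_num_even: "even m \<Longrightarrow> euler_num m = euler_num_gen 1 m"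
  and euler_num_odd: "odd m \<Longrightarrow> euler_num m = sec_tan 0 m 1"
proof -
  have "euler_num m = sec_tan 1 m 0 + sec_tan 0 m 1"
    using fps_sec_powr_of_nat[of 0] fps_sec_powr_of_nat[of 1]
    by (simp add: euler_num_def sec_tan_def algebra_simps)
  thus "even m \<Longrightarrow> euler_num m = euler_num_gen 1 m" "odd m \<Longrightarrow> euler_num m = sec_tan 0 m 1"
    by (simp_all add: sec_tan.parity euler_num_gen_eq_sec_tan(1))
qed

lemma euler_num_Suc_even: "even m \<Longrightarrow> euler_num (Suc m) = euler_num_gen 2 m"
  using fact_Suc_fps_nth[of m "fps_tan (1 :: complex)"] fps_sec_powr_of_nat[of 0] fps_sec_powr_of_nat[of 2]
  by (simp add: euler_num_odd sec_tan_def euler_num_gen_def fps_deriv_tan del: fact_Suc)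

section \<open>Hankel determinants for powers of the secant\<close>

lemma prod_fact_pochhammer:
  "(\<Prod>j<k. of_nat (Suc j) * (r + of_nat j)) = (fact k * pochhammer r k :: 'a :: {comm_semiring_1, semiring_char_0})"
  by (induction k) (simp_all add: pochhammer_rec' algebra_simps)

lemma prod_lessThan_double:
  fixes f :: "nat \<Rightarrow> 'a :: comm_monoid_mult"
  shows "(\<Prod>j<2 * k. f j) = (\<Prod>j<k. f (2 * j) * f (2 * j + 1))"
  by (induction k) (simp_all add: mult_ac)

lemma prod_lessThan_eq_from_1:
  fixes f :: "nat \<Rightarrow> 'a :: comm_monoid_mult"
  assumes "f 0 = 1"
  shows "(\<Prod>k<n. f k) = (\<Prod>k\<in>{1..<n}. f k)"
  using assms by (intro prod.mono_neutral_right) (auto simp: Suc_le_eq)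

lemma hankel_euler_num_gen:
  "hankel (euler_num_gen r) n = (\<Prod>k<n. fact k * pochhammer r k)"
  using sec_tan.hankel_column_0[of r n]
  by (simp only: hankel_cong[OF euler_num_gen_eq_sec_tan(1)] prod_fact_pochhammer)

lemma hankel_euler_num_gen_even:
  "hankel (\<lambda>m. euler_num_gen r (2 * m)) n = (\<Prod>k<n. fact (2 * k) * pochhammer r (2 * k))"
proof -
  let ?l = "\<lambda>k. of_nat (Suc k) * (r + of_nat k)"
  have "hankel (\<lambda>m. euler_num_gen r (2 * m)) n = hankel (\<lambda>m. sec_tan r (2 * m) (2 * 0)) n"
    by (simp add: euler_num_gen_eq_sec_tan(1))
  also have "\<dots> = (\<Prod>k<n. \<Prod>j<k. ?l (2 * j) * ?l (2 * j + 1))"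
    by (rule stieltjes_array.hankel_column_0[OF sec_tan.even_contraction]) simp
  also have "\<dots> = (\<Prod>k<n. fact (2 * k) * pochhammer r (2 * k))"
    by (simp only: prod_lessThan_double[of ?l, symmetric] prod_fact_pochhammer)
  finally show ?thesis .
qed

text \<open>The shift gives r times the odd section of the array. Scaling contributes r^n, and one
  factor \<open>r = l 0\<close> completes each of the n weights to a full initial product of the
  \<open>l j\<close>.\<close>

lemma hankel_euler_num_gen_even_shifted:
  "hankel (\<lambda>m. euler_num_gen r (2 * m + 2)) n = (\<Prod>k<n. fact (2 * k + 1) * pochhammer r (2 * k + 1))"
proof -
  let ?l = "\<lambda>k. of_nat (Suc k) * (r + of_nat k)"
  have weight: "r * (\<Prod>j<k. ?l (2 * j + 1) * ?l (2 * j + 2)) = (\<Prod>j<2 * k + 1. ?l j)" for k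
    by (induction k) (simp_all add: mult_ac)
  have "hankel (\<lambda>m. euler_num_gen r (2 * m + 2)) n = hankel (\<lambda>m. r * sec_tan r (2 * m + 1) (2 * 0 + 1)) n"
    using euler_num_gen_eq_sec_tan(2) by (intro hankel_cong) simp
  also have "\<dots> = r ^ n * (\<Prod>k<n. \<Prod>j<k. ?l (2 * j + 1) * ?l (2 * j + 2))"
    unfolding hankel_scale
    by (subst stieltjes_array.hankel_column_0[OF sec_tan.odd_contraction]) simp_all
  also have "\<dots> = (\<Prod>k<n. r * (\<Prod>j<k. ?l (2 * j + 1) * ?l (2 * j + 2)))"
    by (simp add: prod.distrib)
  also have "\<dots> = (\<Prod>k<n. fact (2 * k + 1) * pochhammer r (2 * k + 1))"
    by (simp only: weight prod_fact_pochhammer)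
  finally show ?thesis .
qed

lemma hankel_sec_tan_1:
  "hankel (\<lambda>m. sec_tan r m 1) (2 * n) = (- 1) ^ n * (\<Prod>k<n. (fact (2 * k + 1) * pochhammer (r + 1) (2 * k))\<^sup>2)"
  "hankel (\<lambda>m. sec_tan r m 1) (2 * n + 1) = 0"
proof -
  have weight: "(\<Prod>j<k. of_nat (Suc (Suc j)) * (r + of_nat (Suc j))) = fact (k + 1) * pochhammer (r + 1) k" for k
    by (induction k) (simp_all add: pochhammer_rec' algebra_simps)
  have "hankel (\<lambda>m. sec_tan r m 1) n = det_tridiag (\<lambda>_. 0) (\<lambda>k. fact (k + 1) * pochhammer (r + 1) k) n" for n
    using sec_tan.hankel_column_1[of r n] by (simp only: weight)
  thus "hankel (\<lambda>m. sec_tan r m 1) (2 * n) = (- 1) ^ n * (\<Prod>k<n. (fact (2 * k + 1) * pochhammer (r + 1) (2 * k))\<^sup>2)"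
    "hankel (\<lambda>m. sec_tan r m 1) (2 * n + 1) = 0"
    by (simp_all only: det_tridiag_offdiagonal)
qed

text \<open>Again r times column 1: the factor r^(2n) puts r^2 into each of the n squares, extending
  \<open>pochhammer (r + 1) (2 * k)\<close> to \<open>pochhammer r (2 * k + 1)\<close>.\<close>

lemma hankel_euler_num_gen_shifted:
  "hankel (\<lambda>m. euler_num_gen r (m + 1)) (2 * n)
    = (- 1) ^ n * (\<Prod>k<n. (fact (2 * k + 1) * pochhammer r (2 * k + 1))\<^sup>2)" (is ?even)
  "hankel (\<lambda>m. euler_num_gen r (m + 1)) (2 * n + 1) = 0" (is ?odd)
proof -
  have eq: "(\<lambda>m. euler_num_gen r (m + 1)) = (\<lambda>m. r * sec_tan r m 1)"
    using euler_num_gen_eq_sec_tan(2) by simp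
  show ?odd unfolding eq hankel_scale hankel_sec_tan_1 by simp
  have "r ^ (2 * n) = (\<Prod>k<n. r\<^sup>2)" by (simp add: power_mult)
  thus ?even unfolding eq hankel_scale hankel_sec_tan_1
    by (simp add: pochhammer_rec power_mult_distrib prod.distrib mult_ac)
qed

section \<open>The full sequence of Euler numbers\<close>

text \<open>With F = tan + sec this is the array of g = F' and f = F - 1; the 1 is subtracted
  because F has constant term 1. Column 0 is E_1, E_2, and so on.\<close>

definition euler_array :: "nat \<Rightarrow> nat \<Rightarrow> complex" where
  "euler_array n k = fact n * fps_nth (fps_deriv (fps_tan 1 + fps_sec) * (fps_tan 1 + fps_sec - 1) ^ k) n / fact k"

text \<open>In terms of f = F - 1 the equation 2 F' = 1 + F^2 reads f' = 1 + f + f^2/2, and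
  differentiating it gives F'' = F F' = F' (1 + f).\<close>

interpretation euler_array: stieltjes_array euler_array "\<lambda>k. of_nat (Suc k)"
    "\<lambda>k. of_nat (Suc k) * of_nat (Suc (Suc k)) / 2"
proof -
  let ?F = "fps_tan 1 + fps_sec"
  have half: "2 * fps_const (1 / 2 :: complex) = 1" by (simp add: numeral_fps_const)
  have F': "fps_deriv ?F = fps_sec\<^sup>2 + fps_tan 1 * fps_sec"
    by (simp add: fps_deriv_tan fps_deriv_sec)
  have "1 + ?F\<^sup>2 = (1 + (fps_tan 1)\<^sup>2) + fps_sec\<^sup>2 + 2 * (fps_tan 1 * fps_sec)"
    by (simp add: power2_eq_square algebra_simps)
  hence "2 * fps_deriv ?F = 1 + ?F\<^sup>2" by (simp add: fps_deriv_tan fps_deriv_sec fps_sec_squared[symmetric])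
  hence "fps_const (1 / 2) * (2 * fps_deriv ?F) = fps_const (1 / 2) * (1 + ?F\<^sup>2)" by simp
  hence f'_half: "fps_deriv ?F = fps_const (1 / 2) * (1 + ?F\<^sup>2)"
    by (metis half mult.assoc mult.commute mult_1)
  have f': "fps_deriv (?F - 1) = 1 + fps_const 1 * (?F - 1) + fps_const (1 / 2) * (?F - 1)\<^sup>2"
  proof -
    have "1 + (G - 1) + c * (G - 1)\<^sup>2 = c * (1 + G\<^sup>2) + (1 - 2 * c) * G" for G c :: "complex fps"
      by (simp add: power2_eq_square algebra_simps)
    from this[of ?F "fps_const (1 / 2)"] show ?thesis
      unfolding half f'_half[symmetric] by simp
  qed
  have "fps_deriv (fps_const c * (1 + G\<^sup>2)) = 2 * fps_const c * (fps_deriv G * G)"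
    for G and c :: complex
    by (simp only: power2_eq_square fps_deriv_const fps_deriv_add fps_deriv_1 fps_deriv_mult mult_2)
      (simp only: mult_zero_left mult_zero_right add_0_left add_0_right distrib_left distrib_right mult_ac)
  from this[of "1 / 2" ?F] have g': "fps_deriv (fps_deriv ?F) = fps_deriv ?F * (fps_const 1 + fps_const 1 * (?F - 1))"
    unfolding half f'_half[symmetric] by simp
  have "fps_nth (fps_deriv ?F) 0 = 1" unfolding F' by (simp add: power2_eq_square)
  with f' g' have "stieltjes_array euler_array (\<lambda>k. 1 + of_nat k * 1)
      (\<lambda>k. of_nat (Suc k) * (1 + of_nat k * (1 / 2)))"
    using stieltjes_array_riordan[of "?F - 1" "fps_deriv ?F" 1 "1 / 2" 1 1]
    unfolding euler_array_def[abs_def] by simp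
  moreover have "(\<lambda>k. 1 + of_nat k * 1) = (\<lambda>k. of_nat (Suc k) :: complex)" by simp
  moreover have "(\<lambda>k. of_nat (Suc k) * (1 + of_nat k * (1 / 2)))
      = (\<lambda>k. of_nat (Suc k) * of_nat (Suc (Suc k)) / 2 :: complex)"
    by (simp add: field_simps)
  ultimately show "stieltjes_array euler_array (\<lambda>k. of_nat (Suc k))
      (\<lambda>k. of_nat (Suc k) * of_nat (Suc (Suc k)) / 2)"
    by metis
qed

lemma euler_num_Suc: "euler_num (Suc m) = euler_array m 0"
  unfolding euler_num_def euler_array_def fact_Suc_fps_nth by simp

section \<open>The tridiagonal determinant for the sequence starting at E_2\<close>

definition euler_weight :: "nat \<Rightarrow> complex" where
  "euler_weight k = fact k * fact (Suc k) / 2 ^ k"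

lemma prod_euler_weight:
  "(\<Prod>j<k. of_nat (Suc j) * of_nat (Suc (Suc j)) / 2) = euler_weight k"
  by (induction k) (simp_all add: euler_weight_def mult_ac)

text \<open>The characteristic roots are (1 + i)/2 and (1 - i)/2. Their fourth powers equal -1/4,
  which explains the dependence on n modulo 4.\<close>

fun half_rec :: "nat \<Rightarrow> complex" where
  "half_rec 0 = 1"
| "half_rec (Suc 0) = 1"
| "half_rec (Suc (Suc n)) = half_rec (Suc n) - half_rec n / 2"

lemma half_rec_mod_4:
  "half_rec (4 * k) = (- 1 / 4) ^ k"
  "half_rec (4 * k + 1) = (- 1 / 4) ^ k"
  "half_rec (4 * k + 2) = (- 1 / 4) ^ k / 2"
  "half_rec (4 * k + 3) = 0"
proof -
  have "half_rec (4 * k) = (- 1 / 4) ^ k \<and> half_rec (Suc (4 * k)) = (- 1 / 4) ^ k"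
  proof (induction k)
    case (Suc k)
    have "4 * Suc k = Suc (Suc (Suc (Suc (4 * k))))" by simp
    with Suc show ?case by (simp only: half_rec.simps) simp
  qed simp
  thus "half_rec (4 * k) = (- 1 / 4) ^ k" "half_rec (4 * k + 1) = (- 1 / 4) ^ k"
    "half_rec (4 * k + 2) = (- 1 / 4) ^ k / 2" "half_rec (4 * k + 3) = 0"
    by (simp_all add: numeral_3_eq_3)
qed

text \<open>The product of the diagonal entries \<open>of_nat (Suc k) * euler_weight k\<close> for k
  < n.\<close>

definition euler_prod :: "nat \<Rightarrow> complex" where
  "euler_prod n = fact n * (\<Prod>k<n. euler_weight k)"

lemma euler_prod_Suc: "euler_prod (Suc n) = euler_prod n * (fact (Suc n))\<^sup>2 / 2 ^ n"
  by (simp add: euler_prod_def euler_weight_def power2_eq_square)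

text \<open>After division by the product of the diagonal entries d, the coefficient of the last
  term in the continuant recurrence is e(n)^2 / (d(n) d(n+1)) = l(n) / ((n+1)(n+2)) = 1/2,
  independent of n. This is the recurrence of \<open>half_rec\<close>.\<close>

lemma hankel_euler_num_2: "hankel (\<lambda>m. euler_num (m + 2)) n = half_rec n * euler_prod n"
proof -
  have "det_tridiag (\<lambda>k. of_nat (Suc k) * euler_weight k) (\<lambda>k. euler_weight (Suc k)) n
      = half_rec n * euler_prod n"
  proof (induction n rule: induct_nat_012)
    case (ge2 n)
    let ?P = "\<Prod>k<n. euler_weight k"
    have w: "euler_weight (Suc n) = of_nat (Suc n) * of_nat (Suc (Suc n)) / 2 * euler_weight n"
      by (simp add: euler_weight_def field_simps)
    \<comment> \<open>Only one of the two factors is expanded; the other one is shared with the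
      diagonal term.\<close>
    have w2: "(euler_weight (Suc n))\<^sup>2
        = euler_weight (Suc n) * (of_nat (Suc n) * of_nat (Suc (Suc n)) / 2 * euler_weight n)"
      by (simp only: power2_eq_square) (simp only: w)
    have "det_tridiag (\<lambda>k. of_nat (Suc k) * euler_weight k) (\<lambda>k. euler_weight (Suc k)) (Suc (Suc n))
      = of_nat (Suc (Suc n)) * euler_weight (Suc n) * (half_rec (Suc n) * (of_nat (Suc n) * fact n * (?P * euler_weight n)))
        - euler_weight (Suc n) * (of_nat (Suc n) * of_nat (Suc (Suc n)) / 2 * euler_weight n) * (half_rec n * (fact n * ?P))"
      unfolding det_tridiag_Suc_Suc ge2 euler_prod_def w2 prod.lessThan_Suc fact_Suc[of n] by simp
    also have "\<dots> = half_rec (Suc (Suc n)) * (of_nat (Suc (Suc n)) * (of_nat (Suc n) * fact n) * (?P * euler_weight n * euler_weight (Suc n)))"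
      by (simp add: algebra_simps del: of_nat_Suc fact_Suc)
    also have "\<dots> = half_rec (Suc (Suc n)) * euler_prod (Suc (Suc n))"
      by (simp only: euler_prod_def prod.lessThan_Suc fact_Suc of_nat_mult of_nat_fact)
    finally show ?case .
  qed (simp_all add: det_tridiag_0 det_tridiag_1 euler_prod_def euler_weight_def)
  thus ?thesis
    using euler_array.hankel_shifted_column_0[of n]
    by (simp only: prod_euler_weight euler_num_Suc[symmetric]) simp
qed

text \<open>Factors are taken in pairs: (2m+2)! = 2 (m+1) (2m+1)! turns a pair of squares into a
  fourth power of (2m+1)! times 4 (m+1)^2. The exponent of the denominator is 0 + 1 + ... +
  (2m-1).\<close>

lemma euler_prod_even:
  "euler_prod (2 * m) = 4 ^ m * (fact m)\<^sup>2 * (\<Prod>j<m. (fact (2 * j + 1)) ^ 4) / 2 ^ (m * (2 * m - 1))"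
proof (induction m)
  case (Suc m)
  have e: "(2::complex) ^ (Suc m * (2 * Suc m - 1)) = 2 ^ (m * (2 * m - 1)) * 2 ^ (2 * m) * 2 ^ Suc (2 * m)"
    by (cases m) (simp_all flip: power_add add: algebra_simps)
  have f: "fact (Suc (Suc (2 * m))) = 2 * of_nat (Suc m) * (fact (2 * m + 1) :: complex)"
    by (simp add: algebra_simps)
  have "euler_prod (2 * Suc m)
      = euler_prod (2 * m) * (fact (2 * m + 1))\<^sup>2 / 2 ^ (2 * m) * (fact (Suc (Suc (2 * m))))\<^sup>2 / 2 ^ Suc (2 * m)"
    by (simp add: euler_prod_Suc del: fact_Suc power_Suc)
  also have "\<dots> = 4 ^ Suc m * (fact (Suc m))\<^sup>2 * (\<Prod>j<Suc m. (fact (2 * j + 1)) ^ 4) / 2 ^ (Suc m * (2 * Suc m - 1))"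
    unfolding Suc.IH e f fact_Suc[of m] prod.lessThan_Suc
    by (simp add: power_mult_distrib mult_ac power2_eq_square power4_eq_xxxx del: fact_Suc of_nat_Suc)
  finally show ?case .
qed (simp add: euler_prod_def)

section \<open>Hankel determinants of Euler numbers\<close>

lemma euler_num_gen_odd: "odd m \<Longrightarrow> euler_num_gen r m = 0"
  by (simp add: euler_num_gen_eq_sec_tan(1) sec_tan.parity)

lemma pochhammer_2: "pochhammer 2 k = (fact (Suc k) :: 'a :: field_char_0)"
  using pochhammer_rec[of "1 :: 'a" k] by (simp add: pochhammer_fact)

lemma hankel_euler_num_even_interleaved:
  "hankel (\<lambda>m. if even m then euler_num m else 0) n = (\<Prod>k<n. (fact k)\<^sup>2)"
proof -
  have "(if even m then euler_num m else 0) = euler_num_gen 1 m" for m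
    by (simp add: euler_num_even euler_num_gen_odd)
  thus ?thesis
    by (simp add: hankel_euler_num_gen pochhammer_fact[symmetric] power2_eq_square)
qed

lemma hankel_euler_num_even:
  "hankel (\<lambda>m. euler_num (2 * m)) n = (\<Prod>k<n. (fact (2 * k))\<^sup>2)"
  by (simp add: euler_num_even hankel_euler_num_gen_even pochhammer_fact[symmetric] power2_eq_square)

lemma hankel_euler_num_even_shifted:
  "hankel (\<lambda>m. euler_num (2 * m + 2)) n = (\<Prod>k<n. (fact (2 * k + 1))\<^sup>2)"
  using hankel_euler_num_gen_even_shifted[of 1 n]
  by (simp add: euler_num_even pochhammer_fact[symmetric] power2_eq_square del: fact_Suc)

text \<open>For \<open>r = 2\<close> the k-th factor is k! (k+1)!; the extracted factors k + 1
  multiply to n!.\<close>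

lemma hankel_euler_num_odd_interleaved:
  "hankel (\<lambda>m. if even m then euler_num (m + 1) else 0) n = fact n * (\<Prod>k<n. (fact k)\<^sup>2)"
proof -
  have "(if even m then euler_num (m + 1) else 0) = euler_num_gen 2 m" for m
    by (simp add: euler_num_Suc_even euler_num_gen_odd)
  hence "hankel (\<lambda>m. if even m then euler_num (m + 1) else 0) n = (\<Prod>k<n. fact k * fact (Suc k))"
    by (simp add: hankel_euler_num_gen pochhammer_2 del: fact_Suc)
  also have "\<dots> = fact n * (\<Prod>k<n. (fact k)\<^sup>2)"
    by (induction n) (simp_all add: power2_eq_square)
  finally show ?thesis .
qed

lemma hankel_euler_num_odd:
  "hankel (\<lambda>m. euler_num (2 * m + 1)) n = (\<Prod>k<2 * n. fact k)"
  by (simp add: euler_num_Suc_even hankel_euler_num_gen_even pochhammer_2 prod_lessThan_double del: fact_Suc)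

lemma prod_fact_Suc: "(\<Prod>k<n. fact (Suc k)) = (\<Prod>k\<in>{1..n}. fact k)"
  by (induction n) (simp_all del: fact_Suc)

lemma hankel_euler_num_odd_shifted:
  "hankel (\<lambda>m. euler_num (2 * m + 3)) n = (\<Prod>k\<in>{1..2 * n}. fact k)"
proof -
  have "euler_num (2 * m + 3) = euler_num_gen 2 (2 * m + 2)" for m
  proof -
    have "2 * m + 3 = Suc (2 * m + 2)" by simp
    thus ?thesis using euler_num_Suc_even[of "2 * m + 2"] by (simp only:) simp
  qed
  thus ?thesis
    by (simp only: hankel_euler_num_gen_even_shifted pochhammer_2 prod_fact_Suc[symmetric] prod_lessThan_double)
      (simp del: fact_Suc)
qed

text \<open>This is column 1 for \<open>r = 0\<close>, where the factors (2k)! and (2k+1)!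
  interleave to a product over all k < 2n.\<close>

lemma hankel_tan:
  "hankel (\<lambda>m. if odd m then euler_num m else 0) (2 * n) = (- 1) ^ n * (\<Prod>k<2 * n. (fact k)\<^sup>2)"
  "hankel (\<lambda>m. if odd m then euler_num m else 0) (2 * n + 1) = 0"
proof -
  have "(if odd m then euler_num m else 0) = sec_tan 0 m 1" for m
    by (simp add: euler_num_odd sec_tan.parity)
  moreover have "(fact (2 * k + 1) * pochhammer (0 + 1) (2 * k))\<^sup>2
      = (fact (2 * k))\<^sup>2 * (fact (2 * k + 1) :: complex)\<^sup>2" for k
    by (simp add: pochhammer_fact[symmetric] power_mult_distrib del: fact_Suc)
  ultimately show "hankel (\<lambda>m. if odd m then euler_num m else 0) (2 * n) = (- 1) ^ n * (\<Prod>k<2 * n. (fact k)\<^sup>2)"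
    "hankel (\<lambda>m. if odd m then euler_num m else 0) (2 * n + 1) = 0"
    using hankel_sec_tan_1[of 0 n] by (simp_all only: prod_lessThan_double)
qed

lemma hankel_euler_num_even_alternating:
  "hankel (\<lambda>m. if odd m then euler_num (m + 1) else 0) (2 * n)
    = (- 1) ^ n * (\<Prod>k<n. (fact (2 * k + 1)) ^ 4)"
  "hankel (\<lambda>m. if odd m then euler_num (m + 1) else 0) (2 * n + 1) = 0"
proof -
  have "(if odd m then euler_num (m + 1) else 0) = euler_num_gen 1 (m + 1)" for m
    by (cases "odd m") (simp_all add: euler_num_even euler_num_gen_odd)
  thus "hankel (\<lambda>m. if odd m then euler_num (m + 1) else 0) (2 * n)
      = (- 1) ^ n * (\<Prod>k<n. (fact (2 * k + 1)) ^ 4)"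
    "hankel (\<lambda>m. if odd m then euler_num (m + 1) else 0) (2 * n + 1) = 0"
    by (simp_all only: hankel_euler_num_gen_shifted pochhammer_fact[symmetric])
      (simp add: power4_eq_xxxx power2_eq_square mult.assoc del: fact_Suc)
qed

lemma hankel_euler_num_odd_alternating:
  "hankel (\<lambda>m. if odd m then euler_num (m + 2) else 0) (2 * n)
    = (- 1) ^ n * (\<Prod>k\<in>{1..2 * n}. (fact k)\<^sup>2)"
  "hankel (\<lambda>m. if odd m then euler_num (m + 2) else 0) (2 * n + 1) = 0"
proof -
  have "(if odd m then euler_num (m + 2) else 0) = euler_num_gen 2 (m + 1)" for m
    using euler_num_Suc_even[of "Suc m"] by (cases "odd m") (simp_all add: euler_num_gen_odd)
  moreover have "(\<Prod>k<n. (fact (2 * k + 1) * pochhammer 2 (2 * k + 1))\<^sup>2) = (\<Prod>k\<in>{1..2 * n}. (fact k)\<^sup>2 :: complex)"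
    unfolding prod_power_distrib[symmetric] pochhammer_2 prod_fact_Suc[symmetric] prod_lessThan_double
    by (simp del: fact_Suc)
  ultimately show "hankel (\<lambda>m. if odd m then euler_num (m + 2) else 0) (2 * n)
      = (- 1) ^ n * (\<Prod>k\<in>{1..2 * n}. (fact k)\<^sup>2)"
    "hankel (\<lambda>m. if odd m then euler_num (m + 2) else 0) (2 * n + 1) = 0"
    by (simp_all only: hankel_euler_num_gen_shifted)
qed

lemma hankel_euler_num_1:
  "hankel (\<lambda>m. euler_num (m + 1)) n = fact n / 2 ^ (n * (n - 1) div 2) * (\<Prod>k<n. (fact k)\<^sup>2)"
proof -
  have "(\<Prod>k<n. euler_weight k) = fact n / 2 ^ (n * (n - 1) div 2) * (\<Prod>k<n. (fact k)\<^sup>2)"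
  proof (induction n)
    case (Suc n)
    have "Suc n * n div 2 = n * (n - 1) div 2 + n" by (cases n) simp_all
    thus ?case using Suc by (simp add: euler_weight_def power_add power2_eq_square mult_ac)
  qed simp
  thus ?thesis
    using euler_array.hankel_column_0[of n]
    by (simp only: prod_euler_weight euler_num_Suc Suc_eq_plus1[symmetric])
qed

text \<open>What remains is to reconcile the powers of 2 coming from \<open>half_rec\<close> and
  \<open>euler_prod\<close>.\<close>

lemma hankel_euler_num_2_mod_4:
  "hankel (\<lambda>m. euler_num (m + 2)) (4 * k) = (- 1) ^ k * (fact (2 * k))\<^sup>2 / 2 ^ (8 * k\<^sup>2 - 4 * k)
    * (\<Prod>j<2 * k. (fact (2 * j + 1)) ^ 4)" (is ?H0)
  "hankel (\<lambda>m. euler_num (m + 2)) (4 * k + 1) = (- 1) ^ k * (fact (2 * k))\<^sup>2 / 2 ^ (8 * k\<^sup>2)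
    * (fact (4 * k + 1))\<^sup>2 * (\<Prod>j<2 * k. (fact (2 * j + 1)) ^ 4)" (is ?H1)
  "hankel (\<lambda>m. euler_num (m + 2)) (4 * k + 2) = (- 1) ^ k * (fact (2 * k + 1))\<^sup>2 / 2 ^ (8 * k\<^sup>2 + 4 * k)
    * (\<Prod>j<2 * k + 1. (fact (2 * j + 1)) ^ 4)" (is ?H2)
proof -
  have four: "4 ^ i = (2 :: complex) ^ (2 * i)" for i by (simp add: power_mult)
  have quarter: "(- 1 / 4 :: complex) ^ k = (- 1) ^ k / 4 ^ k" by (rule power_divide)
  \<comment> \<open>\<open>c / d\<close> is the value of \<open>half_rec\<close>, \<open>X\<close>
    and \<open>a\<close> are the powers of 2 in \<open>euler_prod_even\<close>, and \<open>Y\<close>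
    is the power wanted.\<close>
  have cancel: "c / d * (a * F * P / X) = c * F / Y * P"
    if "X * d = Y * a" "d \<noteq> 0" "X \<noteq> 0" "Y \<noteq> 0" for c d a F P X Y :: complex
  proof -
    have "a \<noteq> 0" using that by auto
    hence "a / (d * X) = 1 / Y" using that by (simp add: frac_eq_eq mult.commute)
    hence "c * F * P * (a / (d * X)) = c * F * P * (1 / Y)" by simp
    thus ?thesis by (simp add: mult_ac)
  qed
  have "k \<le> k\<^sup>2" by (simp add: power2_eq_square)
  \<comment> \<open>Ensures that the natural number subtraction in the exponent is exact.\<close>
  hence k: "4 * k \<le> 8 * k\<^sup>2" by linarith
  have "2 * k * (2 * (2 * k) - 1) + 2 * k = 8 * k\<^sup>2"
    by (cases k) (simp_all add: power2_eq_square)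
  hence "2 * k * (2 * (2 * k) - 1) + 2 * k = 8 * k\<^sup>2 - 4 * k + 2 * (2 * k)" using k by simp
  hence "(2 :: complex) ^ (2 * k * (2 * (2 * k) - 1)) * 4 ^ k = 2 ^ (8 * k\<^sup>2 - 4 * k) * 4 ^ (2 * k)"
    by (simp only: four power_add[symmetric])
  hence H0: "half_rec (4 * k) * euler_prod (2 * (2 * k))
      = (- 1) ^ k * (fact (2 * k))\<^sup>2 / 2 ^ (8 * k\<^sup>2 - 4 * k) * (\<Prod>j<2 * k. (fact (2 * j + 1)) ^ 4)"
    unfolding half_rec_mod_4 quarter euler_prod_even by (rule cancel) simp_all
  moreover have "2 * (2 * k) = 4 * k" by simp
  ultimately show ?H0 by (simp only: hankel_euler_num_2)
  have "half_rec (4 * k + 1) = half_rec (4 * k)" by (simp only: half_rec_mod_4)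
  moreover have "euler_prod (4 * k + 1) = euler_prod (2 * (2 * k)) * (fact (4 * k + 1))\<^sup>2 / 2 ^ (4 * k)"
    using euler_prod_Suc[of "4 * k"] by (simp del: fact_Suc)
  ultimately have "half_rec (4 * k + 1) * euler_prod (4 * k + 1)
      = half_rec (4 * k) * euler_prod (2 * (2 * k)) * (fact (4 * k + 1))\<^sup>2 / 2 ^ (4 * k)"
    by (simp only: times_divide_eq_right mult.assoc)
  moreover have "(2 :: complex) ^ (8 * k\<^sup>2) = 2 ^ (8 * k\<^sup>2 - 4 * k) * 2 ^ (4 * k)"
    unfolding power_add[symmetric] using k by simp
  ultimately show ?H1
    unfolding hankel_euler_num_2 H0 by (simp only: divide_divide_eq_left times_divide_eq_left times_divide_eq_right mult_ac)
  have e: "(2 * k + 1) * (2 * (2 * k + 1) - 1) + (2 * k + 1) = 8 * k\<^sup>2 + 4 * k + 2 * (2 * k + 1)"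
    by (simp add: power2_eq_square algebra_simps)
  have "(2 :: complex) ^ ((2 * k + 1) * (2 * (2 * k + 1) - 1)) * (4 ^ k * 2)
      = 2 ^ ((2 * k + 1) * (2 * (2 * k + 1) - 1) + (2 * k + 1))"
    by (simp only: four power_add power_one_right)
  also have "\<dots> = 2 ^ (8 * k\<^sup>2 + 4 * k) * 4 ^ (2 * k + 1)"
    unfolding e four by (rule power_add)
  finally have "(2 :: complex) ^ ((2 * k + 1) * (2 * (2 * k + 1) - 1)) * (4 ^ k * 2)
      = 2 ^ (8 * k\<^sup>2 + 4 * k) * 4 ^ (2 * k + 1)" .
  hence "half_rec (4 * k + 2) * euler_prod (2 * (2 * k + 1))
      = (- 1) ^ k * (fact (2 * k + 1))\<^sup>2 / 2 ^ (8 * k\<^sup>2 + 4 * k) * (\<Prod>j<2 * k + 1. (fact (2 * j + 1)) ^ 4)"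
    unfolding half_rec_mod_4 quarter euler_prod_even divide_divide_eq_left by (rule cancel) simp_all
  moreover have "euler_prod (4 * k + 2) = euler_prod (2 * (2 * k + 1))" by simp
  ultimately show ?H2 by (simp only: hankel_euler_num_2)
qed

section \<open>All the determinants together, with products rewritten over the stated ranges\<close>

theorem theorem5p2:
  fixes r :: complex and n :: nat
  shows
   "\<comment> \<open>H1\<close>
    hankel (\<lambda>m. if even m then euler_num_gen r m else 0) n
      = (\<Prod>k\<in>{1..<n}. fact k * pochhammer r k) \<and>
    hankel (\<lambda>m. if even m then euler_num m else 0) n
      = (\<Prod>k\<in>{1..<n}. (fact k)\<^sup>2) \<and>
    \<comment> \<open>H2\<close>
    hankel (\<lambda>m. euler_num_gen r (2 * m)) n
      = (\<Prod>k\<in>{1..<n}. fact (2 * k) * pochhammer r (2 * k)) \<and>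
    hankel (\<lambda>m. euler_num (2 * m)) n
      = (\<Prod>k\<in>{1..<n}. (fact (2 * k))\<^sup>2) \<and>
    \<comment> \<open>H3\<close>
    hankel (\<lambda>m. euler_num_gen r (2 * m + 2)) n
      = (\<Prod>k\<in>{0..<n}. fact (2 * k + 1) * pochhammer r (2 * k + 1)) \<and>
    hankel (\<lambda>m. euler_num (2 * m + 2)) n
      = (\<Prod>k\<in>{1..<n}. (fact (2 * k + 1))\<^sup>2) \<and>
    \<comment> \<open>H4\<close>
    hankel (\<lambda>m. if even m then euler_num (m + 1) else 0) n
      = fact n * (\<Prod>k\<in>{1..<n}. (fact k)\<^sup>2) \<and>
    \<comment> \<open>H5\<close>
    hankel (\<lambda>m. euler_num (2 * m + 1)) n
      = (\<Prod>k\<in>{1..<2 * n}. fact k) \<and>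
    \<comment> \<open>H6\<close>
    hankel (\<lambda>m. euler_num (2 * m + 3)) n
      = (\<Prod>k\<in>{1..2 * n}. fact k) \<and>
    \<comment> \<open>H7\<close>
    hankel (\<lambda>m. euler_num (m + 1)) n
      = fact n / 2 ^ (n * (n - 1) div 2) * (\<Prod>k\<in>{2..<n}. (fact k)\<^sup>2) \<and>
    \<comment> \<open>H8\<close>
    (r \<noteq> 0 \<longrightarrow>
      hankel (\<lambda>m. if odd m then euler_num_gen r (m + 1) / r else 0) (2 * n + 1) = 0 \<and>
      hankel (\<lambda>m. if odd m then euler_num_gen r (m + 1) / r else 0) (2 * n)
        = (- 1) ^ n * (\<Prod>k\<in>{1..<n}. (fact (2 * k + 1) * pochhammer (r + 1) (2 * k))\<^sup>2)) \<and>
    hankel (\<lambda>m. if odd m then euler_num_gen r (m + 1) else 0) (2 * n + 1) = 0 \<and>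
    (n \<ge> 1 \<longrightarrow>
      hankel (\<lambda>m. if odd m then euler_num_gen r (m + 1) else 0) (2 * n)
        = (- 1) ^ n * r\<^sup>2
            * (\<Prod>k\<in>{1..<n}. (fact (2 * k + 1) * pochhammer r (2 * k + 1))\<^sup>2)) \<and>
    hankel (\<lambda>m. if odd m then euler_num (m + 1) else 0) (2 * n + 1) = 0 \<and>
    hankel (\<lambda>m. if odd m then euler_num (m + 1) else 0) (2 * n)
      = (- 1) ^ n * (\<Prod>k\<in>{1..<n}. (fact (2 * k + 1)) ^ 4) \<and>
    \<comment> \<open>H9\<close>
    hankel (\<lambda>m. if odd m then euler_num m else 0) (2 * n + 1) = 0 \<and>
    hankel (\<lambda>m. if odd m then euler_num m else 0) (2 * n)
      = (- 1) ^ n * (\<Prod>k\<in>{1..<2 * n}. (fact k)\<^sup>2) \<and>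
    \<comment> \<open>H10\<close>
    hankel (\<lambda>m. euler_num (m + 2)) 0 = 1 \<and>
    (\<forall>k\<ge>1. hankel (\<lambda>m. euler_num (m + 2)) (4 * k)
      = (- 1) ^ k * (of_nat k)\<^sup>2 * (fact (2 * k - 1))\<^sup>2 / 2 ^ (8 * k\<^sup>2 - 4 * k - 2)
          * (\<Prod>j\<in>{1..<2 * k}. (fact (2 * j + 1)) ^ 4)) \<and>
    (\<forall>k. hankel (\<lambda>m. euler_num (m + 2)) (4 * k + 1)
      = (- 1) ^ k * (fact (2 * k))\<^sup>2 / (2 ^ (8 * k\<^sup>2) * (fact (4 * k + 1))\<^sup>2)
          * (\<Prod>j\<in>{1..2 * k}. (fact (2 * j + 1)) ^ 4)) \<and>
    (\<forall>k. hankel (\<lambda>m. euler_num (m + 2)) (4 * k + 2)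
      = (- 1) ^ k * (fact (2 * k + 1))\<^sup>2 / 2 ^ (8 * k\<^sup>2 + 4 * k)
          * (\<Prod>j\<in>{1..2 * k}. (fact (2 * j + 1)) ^ 4)) \<and>
    (\<forall>k. hankel (\<lambda>m. euler_num (m + 2)) (4 * k + 3) = 0) \<and>
    \<comment> \<open>H11\<close>
    hankel (\<lambda>m. if odd m then euler_num (m + 2) else 0) (2 * n + 1) = 0 \<and>
    hankel (\<lambda>m. if odd m then euler_num (m + 2) else 0) (2 * n)
      = (- 1) ^ n * (\<Prod>k\<in>{1..2 * n}. (fact k)\<^sup>2)"
proof (intro conjI allI impI)
  have from_1: "f 0 = 1 \<Longrightarrow> (\<Prod>k<m. f k) = (\<Prod>k\<in>{1..<m}. f k)" for f :: "nat \<Rightarrow> complex" and m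
    by (rule prod_lessThan_eq_from_1)
  show "hankel (\<lambda>m. if even m then euler_num_gen r m else 0) n = (\<Prod>k\<in>{1..<n}. fact k * pochhammer r k)"
  proof -
    have "(if even m then euler_num_gen r m else 0) = euler_num_gen r m" for m
      by (simp add: euler_num_gen_odd)
    thus ?thesis by (simp only: hankel_euler_num_gen) (rule from_1, simp)
  qed
  show "hankel (\<lambda>m. if even m then euler_num m else 0) n = (\<Prod>k\<in>{1..<n}. (fact k)\<^sup>2)"
    unfolding hankel_euler_num_even_interleaved by (rule from_1) simp
  show "hankel (\<lambda>m. euler_num_gen r (2 * m)) n = (\<Prod>k\<in>{1..<n}. fact (2 * k) * pochhammer r (2 * k))"
    unfolding hankel_euler_num_gen_even by (rule from_1) simp
  show "hankel (\<lambda>m. euler_num (2 * m)) n = (\<Prod>k\<in>{1..<n}. (fact (2 * k))\<^sup>2)"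
    unfolding hankel_euler_num_even by (rule from_1) simp
  show "hankel (\<lambda>m. euler_num_gen r (2 * m + 2)) n
      = (\<Prod>k\<in>{0..<n}. fact (2 * k + 1) * pochhammer r (2 * k + 1))"
    unfolding hankel_euler_num_gen_even_shifted lessThan_atLeast0 ..
  show "hankel (\<lambda>m. euler_num (2 * m + 2)) n = (\<Prod>k\<in>{1..<n}. (fact (2 * k + 1))\<^sup>2)"
    unfolding hankel_euler_num_even_shifted by (rule from_1) simp
  show "hankel (\<lambda>m. if even m then euler_num (m + 1) else 0) n = fact n * (\<Prod>k\<in>{1..<n}. (fact k)\<^sup>2)"
    unfolding hankel_euler_num_odd_interleaved by (subst from_1) simp_all
  show "hankel (\<lambda>m. euler_num (2 * m + 1)) n = (\<Prod>k\<in>{1..<2 * n}. fact k)"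
    unfolding hankel_euler_num_odd by (rule from_1) simp
  show "hankel (\<lambda>m. euler_num (2 * m + 3)) n = (\<Prod>k\<in>{1..2 * n}. fact k)"
    by (rule hankel_euler_num_odd_shifted)
  show "hankel (\<lambda>m. euler_num (m + 1)) n
      = fact n / 2 ^ (n * (n - 1) div 2) * (\<Prod>k\<in>{2..<n}. (fact k)\<^sup>2)"
  proof -
    have "(\<Prod>k<n. (fact k)\<^sup>2 :: complex) = (\<Prod>k\<in>{2..<n}. (fact k)\<^sup>2)"
    proof (rule prod.mono_neutral_right)
      show "\<forall>k\<in>{..<n} - {2..<n}. (fact k)\<^sup>2 = (1 :: complex)"
        by (auto simp: numeral_2_eq_2 not_le less_Suc_eq)
    qed auto
    thus ?thesis by (simp only: hankel_euler_num_1)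
  qed
  {
    assume "r \<noteq> 0"
    hence "(if odd m then euler_num_gen r (m + 1) / r else 0) = sec_tan r m 1" for m
      by (simp add: euler_num_gen_eq_sec_tan(2) sec_tan.parity)
    note eq = hankel_cong[OF this]
    show "hankel (\<lambda>m. if odd m then euler_num_gen r (m + 1) / r else 0) (2 * n + 1) = 0"
      unfolding eq by (rule hankel_sec_tan_1)
    show "hankel (\<lambda>m. if odd m then euler_num_gen r (m + 1) / r else 0) (2 * n)
        = (- 1) ^ n * (\<Prod>k\<in>{1..<n}. (fact (2 * k + 1) * pochhammer (r + 1) (2 * k))\<^sup>2)"
      unfolding eq hankel_sec_tan_1 by (subst from_1) simp_all
  }
  have "(if odd m then euler_num_gen r (m + 1) else 0) = euler_num_gen r (m + 1)" for m
    by (simp add: euler_num_gen_odd)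
  note eq = hankel_cong[OF this]
  show "hankel (\<lambda>m. if odd m then euler_num_gen r (m + 1) else 0) (2 * n + 1) = 0"
    unfolding eq by (rule hankel_euler_num_gen_shifted)
  show "hankel (\<lambda>m. if odd m then euler_num_gen r (m + 1) else 0) (2 * n)
      = (- 1) ^ n * r\<^sup>2 * (\<Prod>k\<in>{1..<n}. (fact (2 * k + 1) * pochhammer r (2 * k + 1))\<^sup>2)" if "n \<ge> 1"
  proof -
    \<comment> \<open>The factor at \<open>k = 0\<close> is r^2; it is present only for
      \<open>n \<ge> 1\<close>.\<close>
    have "{..<n} = insert 0 {1..<n}" using that by auto
    thus ?thesis unfolding eq hankel_euler_num_gen_shifted by simp
  qed
  show "hankel (\<lambda>m. if odd m then euler_num (m + 1) else 0) (2 * n + 1) = 0"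
    by (rule hankel_euler_num_even_alternating)
  show "hankel (\<lambda>m. if odd m then euler_num (m + 1) else 0) (2 * n)
      = (- 1) ^ n * (\<Prod>k\<in>{1..<n}. (fact (2 * k + 1)) ^ 4)"
    unfolding hankel_euler_num_even_alternating by (subst from_1) simp_all
  show "hankel (\<lambda>m. if odd m then euler_num m else 0) (2 * n + 1) = 0"
    by (rule hankel_tan)
  show "hankel (\<lambda>m. if odd m then euler_num m else 0) (2 * n)
      = (- 1) ^ n * (\<Prod>k\<in>{1..<2 * n}. (fact k)\<^sup>2)"
    unfolding hankel_tan by (subst from_1) simp_all
  show "hankel (\<lambda>m. euler_num (m + 2)) 0 = 1"
    by (simp add: hankel_def)
  show "hankel (\<lambda>m. euler_num (m + 2)) (4 * k)
      = (- 1) ^ k * (of_nat k)\<^sup>2 * (fact (2 * k - 1))\<^sup>2 / 2 ^ (8 * k\<^sup>2 - 4 * k - 2)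
        * (\<Prod>j\<in>{1..<2 * k}. (fact (2 * j + 1)) ^ 4)" if "k \<ge> 1" for k
  proof -
    have "k * 1 \<le> k * k" using that by (intro mult_left_mono) auto
    \<comment> \<open>The 2^2 split off here cancels against the one in (2k)!^2 = 2^2 k^2
      (2k-1)!^2.\<close>
    hence "8 * k\<^sup>2 - 4 * k = (8 * k\<^sup>2 - 4 * k - 2) + 2"
      using that unfolding power2_eq_square by linarith
    hence "(2 :: complex) ^ (8 * k\<^sup>2 - 4 * k) = 2 ^ (8 * k\<^sup>2 - 4 * k - 2) * 2\<^sup>2"
      by (metis power_add)
    moreover have "fact (2 * k) = 2 * of_nat k * (fact (2 * k - 1) :: complex)"
      using that by (subst fact_reduce) simp_all
    hence "(fact (2 * k))\<^sup>2 = 2\<^sup>2 * ((of_nat k)\<^sup>2 * (fact (2 * k - 1) :: complex)\<^sup>2)"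
      by (simp only: power_mult_distrib mult.assoc)
    moreover have "(\<Prod>j<2 * k. (fact (2 * j + 1)) ^ 4 :: complex) = (\<Prod>j\<in>{1..<2 * k}. (fact (2 * j + 1)) ^ 4)"
      by (rule from_1) simp
    ultimately show ?thesis unfolding hankel_euler_num_2_mod_4 by simp
  qed
  have last: "(\<Prod>j<2 * k + 1. (fact (2 * j + 1)) ^ 4 :: complex) = (\<Prod>j\<in>{1..2 * k}. (fact (2 * j + 1)) ^ 4)" for k
    using from_1[of "\<lambda>j. (fact (2 * j + 1)) ^ 4" "2 * k + 1"]
    by (simp add: atLeastLessThanSuc_atLeastAtMost del: prod.lessThan_Suc fact_Suc)
  show "hankel (\<lambda>m. euler_num (m + 2)) (4 * k + 1)
      = (- 1) ^ k * (fact (2 * k))\<^sup>2 / (2 ^ (8 * k\<^sup>2) * (fact (4 * k + 1))\<^sup>2)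
        * (\<Prod>j\<in>{1..2 * k}. (fact (2 * j + 1)) ^ 4)" for k
  proof -
    \<comment> \<open>The factor at \<open>j = 2 * k\<close> is (4k+1)!^4; the square in the
      denominator reduces it to (4k+1)!^2.\<close>
    have "(\<Prod>j<2 * k + 1. (fact (2 * j + 1)) ^ 4 :: complex)
        = (\<Prod>j<2 * k. (fact (2 * j + 1)) ^ 4) * (fact (4 * k + 1)) ^ 4"
      by (simp del: fact_Suc)
    thus ?thesis
      unfolding hankel_euler_num_2_mod_4 last[symmetric]
      by (simp add: power4_eq_xxxx power2_eq_square del: fact_Suc)
  qed
  show "hankel (\<lambda>m. euler_num (m + 2)) (4 * k + 2)
      = (- 1) ^ k * (fact (2 * k + 1))\<^sup>2 / 2 ^ (8 * k\<^sup>2 + 4 * k)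
        * (\<Prod>j\<in>{1..2 * k}. (fact (2 * j + 1)) ^ 4)" for k
    unfolding hankel_euler_num_2_mod_4 last ..
  show "hankel (\<lambda>m. euler_num (m + 2)) (4 * k + 3) = 0" for k
    by (simp only: hankel_euler_num_2 half_rec_mod_4 mult_zero_left)
  show "hankel (\<lambda>m. if odd m then euler_num (m + 2) else 0) (2 * n + 1) = 0"
    by (rule hankel_euler_num_odd_alternating)
  show "hankel (\<lambda>m. if odd m then euler_num (m + 2) else 0) (2 * n)
      = (- 1) ^ n * (\<Prod>k\<in>{1..2 * n}. (fact k)\<^sup>2)"
    by (rule hankel_euler_num_odd_alternating)
qed

end
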